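(* Let $(p_k)_{k\in\mathbb{N}}$ be a probability sequence and let $\rho\geq 1$. Suppose that $(p_k)_{k\in\mathbb{N}}$ is regularly varying with tail index $\rho$. Then for any admissible function $f:\mathbb{N}\to\mathbb{R}^+$, $$\dim\left\{x\in[0,1):\lim_{n\to+\infty}\frac{D_n(x)}{f(n)}=1\right\}=1.$$
   Context: $\mathbb{N}=\{1,2,3,\ldots\}$, $\mathbb{R}^+=(0,\infty)$, and $\dim$ denotes Hausdorff dimension. A probability sequence is a sequence $(p_k)_{k\in\mathbb{N}}$ with $p_k>0$ for every $k$ and $\sum_{k\in\mathbb{N}}p_k=1$. It is regularly varying with tail index $\rho\geq1$ if there exists a slowly varying function $L:\mathbb{N}\to\mathbb{R}^+$ (i.e. $\lim_{k\to\infty}L(\lfloor\lambda k\rfloor)/L(k)=1$ for every $\lambda>0$) such that $\lim_{k\to+\infty}p_k/(k^{-\rho}L(k))=1$. Setting: $(I_k)_{k\in\mathbb{N}}$ is a partition of $[0,1)$ into pairwise disjoint half-open intervals (of the form $[a,b)$) with $\operatorname{diam} I_k=p_k$ for every $k$. The full-branch map $T:[0,1)\to[0,1)$ is $T(x)=(x-\inf I_k)/p_k$ for $x\in I_k$. For $n\in\mathbb{N}$, the digit function $d_n:[0,1)\to\mathbb{N}$ is defined by $d_n(x)=k$ if $T^{n-1}(x)\in I_k$. The distinct-digit count is $D_n(x)=\#\{d_1(x),\ldots,d_n(x)\}$. A function $f:\mathbb{N}\to\mathbb{R}^+$ is admissible if: $f$ is unbounded; $\lim_{n\to+\infty}f(n)\log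 f(n)/n=0$; and $0\leq f(n+1)-f(n)\leq 1$ for every $n\in\mathbb{N}$. *)

theory Defs
  imports "HOL-Analysis.Analysis"
begin

section \<open>Hausdorff measure and dimension\<close>

text \<open>
  Since \<open>0 powr 0 = 0\<close> in HOL, the case \<open>s = 0\<close> is split off, so that nonempty sets have gauge
  \<open>1\<close> and the zero-dimensional measure is the counting measure.
\<close>

definition hausdorff_gauge :: "real \<Rightarrow> 'a::metric_space set \<Rightarrow> ennreal" where
  "hausdorff_gauge s U =
     (if U = {} then 0 else if s = 0 then 1 else ennreal (diameter U powr s))"

text \<open>
  Boundedness is required explicitly because \<open>diameter\<close> is unspecified on unbounded sets. Finite
  covers are included by padding with the empty set.
\<close>

definition hausdorff_premeasure :: "real \<Rightarrow> real \<Rightarrow> 'a::metric_space set \<Rightarrow> ennreal" where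
  "hausdorff_premeasure s \<delta> A =
     (INF U \<in> {U :: nat \<Rightarrow> 'a set. A \<subseteq> (\<Union>i. U i) \<and> (\<forall>i. bounded (U i) \<and> diameter (U i) \<le> \<delta>)}.
        (\<Sum>i. hausdorff_gauge s (U i)))"

definition hausdorff_measure :: "real \<Rightarrow> 'a::metric_space set \<Rightarrow> ennreal" where
  "hausdorff_measure s A = (SUP \<delta> \<in> {0<..}. hausdorff_premeasure s \<delta> A)"

definition hausdorff_dim :: "'a::metric_space set \<Rightarrow> ennreal" where
  "hausdorff_dim A = (INF s \<in> {s. 0 \<le> s \<and> hausdorff_measure s A = 0}. ennreal s)"


section \<open>Probability sequences and regular variation\<close>

text \<open>
  Sequences indexed by the positive integers are functions on \<^typ>\<open>nat\<close> whose value at \<open>0\<close>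
  is irrelevant.
\<close>

definition probability_sequence :: "(nat \<Rightarrow> real) \<Rightarrow> bool" where
  "probability_sequence p \<longleftrightarrow> (\<forall>k\<ge>1. p k > 0) \<and> (p has_sum 1) {1..}"

definition slowly_varying :: "(nat \<Rightarrow> real) \<Rightarrow> bool" where
  "slowly_varying L \<longleftrightarrow>
     (\<forall>k\<ge>1. L k > 0) \<and>
     (\<forall>c::real. c > 0 \<longrightarrow> (\<lambda>k. L (nat \<lfloor>c * real k\<rfloor>) / L k) \<longlonglongrightarrow> 1)"

definition regularly_varying :: "(nat \<Rightarrow> real) \<Rightarrow> real \<Rightarrow> bool" where
  "regularly_varying p \<rho> \<longleftrightarrow>
     (\<exists>L. slowly_varying L \<and> (\<lambda>k. p k / (real k powr (-\<rho>) * L k)) \<longlonglongrightarrow> 1)"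


section \<open>The full-branch map and its digits\<close>

definition interval_partition :: "(nat \<Rightarrow> real) \<Rightarrow> (nat \<Rightarrow> real set) \<Rightarrow> bool" where
  "interval_partition p I \<longleftrightarrow>
     (\<forall>k\<ge>1. \<exists>a b. a < b \<and> I k = {a..<b}) \<and>
     disjoint_family_on I {1..} \<and>
     (\<Union>k\<in>{1..}. I k) = {0..<1} \<and>
     (\<forall>k\<ge>1. diameter (I k) = p k)"

definition branch_index :: "(nat \<Rightarrow> real set) \<Rightarrow> real \<Rightarrow> nat" where
  "branch_index I x = (THE k. k \<ge> 1 \<and> x \<in> I k)"

definition full_branch_map :: "(nat \<Rightarrow> real) \<Rightarrow> (nat \<Rightarrow> real set) \<Rightarrow> real \<Rightarrow> real" where
  "full_branch_map p I x = (x - Inf (I (branch_index I x))) / p (branch_index I x)"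

definition digit :: "(nat \<Rightarrow> real) \<Rightarrow> (nat \<Rightarrow> real set) \<Rightarrow> nat \<Rightarrow> real \<Rightarrow> nat" where
  "digit p I n x = branch_index I ((full_branch_map p I ^^ (n - 1)) x)"

definition distinct_digits :: "(nat \<Rightarrow> real) \<Rightarrow> (nat \<Rightarrow> real set) \<Rightarrow> nat \<Rightarrow> real \<Rightarrow> nat" where
  "distinct_digits p I n x = card ((\<lambda>i. digit p I i x) ` {1..n})"


section \<open>Admissible functions\<close>

definition admissible :: "(nat \<Rightarrow> real) \<Rightarrow> bool" where
  "admissible f \<longleftrightarrow>
     (\<forall>n\<ge>1. f n > 0) \<and>
     \<not> bounded (f ` {1..}) \<and>
     (\<lambda>n. f n * ln (f n) / real n) \<longlonglongrightarrow> 0 \<and>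
     (\<forall>n\<ge>1. 0 \<le> f (n + 1) - f n \<and> f (n + 1) - f n \<le> 1)"

end

theory Submission
  imports Defs "HOL-Probability.Probability"
begin

text \<open>
  The dimension is at most \<open>1\<close> because the set lies in the unit interval
  (\<open>hausdorff_dim_le_1\<close>). For the lower bound fix \<open>s < 1\<close>; a set of positive \<open>s\<close>-dimensional measure
  is found inside the given one by spending almost all digits on dimension and very few on the count.

  Since every \<open>p k\<close> is less than \<open>1\<close>, some partial sum \<open>Z\<close> of the numbers \<open>p k powr s\<close> over
  \<open>k \<le> M\<close> exceeds \<open>1\<close>. Digits are drawn independently from \<open>{1..M}\<close> with probabilities
  \<open>p k powr s / Z\<close>, except that whenever \<open>\<lfloor>f n\<rfloor>\<close> increases the digit is forced to be
  \<open>M + \<lfloor>f n\<rfloor>\<close>, which has not occurred before. The number of distinct digits is then \<open>f n\<close> up to a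
  bounded error (\<open>card_digits_bounds\<close>), so its ratio to \<open>f n\<close> tends to \<open>1\<close>.

  A cylinder of order \<open>n\<close> has mass equal to the \<open>s\<close>-th power of its length, times a gain \<open>1 / Z\<close>
  for each free digit, times a loss for each of the at most \<open>f n\<close> forced digits. Regular
  variation bounds \<open>p k\<close> from below by a power of \<open>k\<close> (\<open>regularly_varying_lower_bound\<close>), which
  makes the total loss \<open>exp (O(f n * ln (f n)))\<close>; this is
  subexponential by admissibility and is absorbed by the gain (\<open>prod_mass_excess_bounded\<close>).

  It remains to pass from cylinders to arbitrary small sets
  (\<open>hausdorff_measure_moran_set_pos\<close>). A set of diameter at most \<open>r\<close> meets only boundedly many of the
  cylinders that are the first of length at most \<open>r\<close> on their branch: a free digit shrinks a cylinder
  by a bounded factor only, and a forced one, which may shrink it a lot, leaves its parent without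
  other children, so that the parent can be counted instead. The mass distribution principle
  concludes.
\<close>

section \<open>Bounds for the Hausdorff dimension\<close>

lemma hausdorff_premeasure_unit_interval_le:
  fixes A :: "real set"
  assumes A: "A \<subseteq> {0..<1}" and N: "N \<ge> 1" "1 / real N \<le> d" and s: "s > 1"
  shows "hausdorff_premeasure s d A \<le> ennreal (real N powr (1 - s))"
proof -
  define U :: "nat \<Rightarrow> real set" where
    "U i = (if i < N then {real i / N .. (real i + 1) / N} else {})" for i
  have diam: "diameter (U i) = 1 / N" "U i \<noteq> {}" if "i < N" for i
    using that N by (auto simp: U_def diameter_closed_interval field_simps)
  have cover: "A \<subseteq> (\<Union>i. U i)"
  proof
    fix x assume "x \<in> A"
    with A have x: "0 \<le> x" "x < 1" by auto
    define i where "i = nat \<lfloor>x * N\<rfloor>"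
    have i: "real i \<le> x * N" "x * N < real i + 1"
      using x by (auto simp: i_def)
    have "x * N < N" using x N by simp
    with i have "i < N" by linarith
    then have "x \<in> U i" using i N by (auto simp: U_def field_simps)
    then show "x \<in> (\<Union>i. U i)" by blast
  qed
  have "hausdorff_premeasure s d A \<le> (\<Sum>i. hausdorff_gauge s (U i))"
    unfolding hausdorff_premeasure_def
  proof (rule INF_lower, safe)
    fix i
    have d0: "0 \<le> d" using N by (smt (verit) divide_nonneg_nonneg of_nat_0_le_iff)
    show "bounded (U i)" by (auto simp: U_def)
    show "diameter (U i) \<le> d" using diam[of i] N d0 by (cases "i < N") (auto simp: U_def)
    fix x assume "x \<in> A" then show "x \<in> (\<Union>i. U i)" using cover by blast
  qed
  also have "\<dots> = (\<Sum>i<N. hausdorff_gauge s (U i))"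
    by (rule suminf_finite) (auto simp: U_def hausdorff_gauge_def)
  also have "\<dots> = (\<Sum>i<N. ennreal ((1 / N) powr s))"
    by (rule sum.cong) (use diam s in \<open>auto simp: hausdorff_gauge_def\<close>)
  also have "\<dots> = ennreal (real N * (1 / N) powr s)"
    by (simp add: ennreal_of_nat_eq_real_of_nat ennreal_mult)
  also have "real N * (1 / N) powr s = real N powr (1 - s)"
    using N by (simp add: powr_divide powr_diff)
  finally show ?thesis .
qed

lemma hausdorff_dim_le_1:
  fixes A :: "real set"
  assumes "A \<subseteq> {0..<1}"
  shows "hausdorff_dim A \<le> 1"
proof (rule ennreal_le_epsilon)
  fix e :: real assume e: "e > 0"
  define s where "s = 1 + e"
  have "hausdorff_premeasure s d A \<le> 0" if d: "d > 0" for d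
  proof (rule tendsto_lowerbound)
    have "(\<lambda>N. real N powr (1 - s)) \<longlonglongrightarrow> 0"
      using e by (intro tendsto_neg_powr filterlim_real_sequentially) (auto simp: s_def)
    then show "(\<lambda>N. ennreal (real N powr (1 - s))) \<longlonglongrightarrow> 0"
      using tendsto_ennrealI by fastforce
    have "eventually (\<lambda>N. real N \<ge> max 1 (1 / d)) sequentially"
      by real_asymp
    then show "eventually (\<lambda>N. hausdorff_premeasure s d A \<le> ennreal (real N powr (1 - s))) sequentially"
    proof eventually_elim
      case (elim N)
      have "N \<ge> 1" "1 / real N \<le> d" using elim d by (auto simp: field_simps)
      then show ?case
        using assms e by (intro hausdorff_premeasure_unit_interval_le) (auto simp: s_def)
    qed
  qed simp
  then have "hausdorff_measure s A = 0"
    by (auto simp: hausdorff_measure_def)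
  then have "hausdorff_dim A \<le> ennreal s"
    unfolding hausdorff_dim_def using e by (intro INF_lower) (auto simp: s_def)
  then show "hausdorff_dim A \<le> 1 + ennreal e"
    using e by (simp add: s_def ennreal_plus)
qed

lemma hausdorff_dim_ge_1:
  assumes "\<And>s. 0 \<le> s \<Longrightarrow> s < 1 \<Longrightarrow> hausdorff_measure s A > 0"
  shows "hausdorff_dim A \<ge> 1"
  unfolding hausdorff_dim_def
proof (rule INF_greatest)
  fix s assume "s \<in> {s. 0 \<le> s \<and> hausdorff_measure s A = 0}"
  with assms[of s] have "1 \<le> s" by force
  then show "1 \<le> ennreal s" by simp
qed

text \<open>
  Radii are positive, so even a set of diameter zero needs one above its diameter; choosing it close
  enough raises the \<open>s\<close>-th power arbitrarily little. For \<open>s = 0\<close> any radius works, as gauge and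
  power are both \<open>1\<close>.
\<close>
lemma radius_above_diameter:
  assumes U: "U \<noteq> {}" "bounded U" "diameter U \<le> 1 / 2" and s: "0 \<le> s" and e: "e > 0"
  obtains r where "0 < r" "r < 1" "diameter U \<le> r"
    "ennreal (r powr s) \<le> hausdorff_gauge s U + ennreal e"
proof (cases "s = 0")
  case True
  show ?thesis
    by (rule that[of "1/2"]) (use U True in \<open>auto simp: hausdorff_gauge_def\<close>)
next
  case False
  define d where "d = diameter U"
  have d: "0 \<le> d" "d \<le> 1/2" using U by (auto simp: d_def diameter_ge_0)
  have "((\<lambda>r. r powr s) \<longlongrightarrow> d powr s) (at_right d)"
    using False s d
    by (intro tendsto_powr' tendsto_intros)
       (auto simp: eventually_at_filter)
  then have "eventually (\<lambda>r. r powr s < d powr s + e) (at_right d)"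
    by (rule order_tendstoD) (use e in auto)
  moreover have "eventually (\<lambda>r. r \<in> {d<..<1}) (at_right d)"
    using d by (intro eventually_at_right_real) auto
  ultimately have "eventually (\<lambda>r. r \<in> {d<..<1} \<and> r powr s < d powr s + e) (at_right d)"
    by eventually_elim auto
  then obtain r where r: "r \<in> {d<..<1}" "r powr s < d powr s + e"
    using eventually_happens trivial_limit_at_right_real by blast
  have "ennreal (r powr s) \<le> ennreal (d powr s + e)"
    using r by (intro ennreal_leI) auto
  also have "\<dots> = hausdorff_gauge s U + ennreal e"
    using False U e by (simp add: hausdorff_gauge_def d_def)
  finally show ?thesis
    using r d that[of r] by (auto simp: d_def)
qed

lemma hausdorff_measure_mono:
  assumes "A \<subseteq> B"
  shows "hausdorff_measure s A \<le> hausdorff_measure s B"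
proof -
  have "hausdorff_premeasure s d A \<le> hausdorff_premeasure s d B" for d
    unfolding hausdorff_premeasure_def by (rule INF_superset_mono) (use assms in auto)
  then show ?thesis unfolding hausdorff_measure_def by (intro SUP_mono) auto
qed

text \<open>
  Mass distribution principle: a probability carried by \<open>A\<close> that gives every set of diameter at most
  \<open>r\<close> mass at most \<open>K r\<^sup>s\<close> forces the masses of any cover, hence the sum of its gauges, to be bounded
  below. The probability lives on a parameter space \<open>P\<close> and is transported by \<open>\<pi>\<close>; asking only for
  a measurable superset of the preimage spares the measurability of \<open>\<pi>\<close>.
\<close>
lemma mass_distribution_principle:
  fixes A :: "'a::metric_space set" and \<pi> :: "'b \<Rightarrow> 'a"
  assumes P: "prob_space P" and G: "AE \<omega> in P. \<omega> \<in> G" and \<pi>: "\<And>\<omega>. \<omega> \<in> G \<Longrightarrow> \<pi> \<omega> \<in> A"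
    and s: "0 \<le> s" and K: "K > 0"
    and mass: "\<And>U r. bounded U \<Longrightarrow> diameter U \<le> r \<Longrightarrow> 0 < r \<Longrightarrow> r < 1 \<Longrightarrow>
      \<exists>B\<in>sets P. {\<omega>\<in>G. \<pi> \<omega> \<in> U} \<subseteq> B \<and> emeasure P B \<le> ennreal (K * r powr s)"
  shows "hausdorff_measure s A > 0"
proof -
  define c where "c = 1 / (2 * K)"
  have c: "c > 0" using K by (simp add: c_def)
  have "ennreal c \<le> hausdorff_premeasure s (1/2) A"
    unfolding hausdorff_premeasure_def
  proof (rule INF_greatest, safe)
    fix U :: "nat \<Rightarrow> 'a set"
    assume cover: "A \<subseteq> (\<Union>i. U i)" and U: "\<forall>i. bounded (U i) \<and> diameter (U i) \<le> 1/2"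
    define e where "e i = c * (1/2) ^ Suc i" for i
    have e: "e i > 0" for i using c by (simp add: e_def)
    have "\<exists>B\<in>sets P. {\<omega>\<in>G. \<pi> \<omega> \<in> U i} \<subseteq> B \<and>
        emeasure P B \<le> ennreal K * (hausdorff_gauge s (U i) + ennreal (e i))" for i
    proof (cases "U i = {}")
      case True
      then show ?thesis by (intro bexI[of _ "{}"]) auto
    next
      case False
      obtain r where r: "0 < r" "r < 1" "diameter (U i) \<le> r"
        "ennreal (r powr s) \<le> hausdorff_gauge s (U i) + ennreal (e i)"
        using radius_above_diameter[OF False] U s e by metis
      obtain B where B: "B \<in> sets P" "{\<omega>\<in>G. \<pi> \<omega> \<in> U i} \<subseteq> B"
        "emeasure P B \<le> ennreal (K * r powr s)"
        using mass[of "U i" r] U r by blast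
      have "ennreal (K * r powr s) = ennreal K * ennreal (r powr s)"
        using K by (simp add: ennreal_mult)
      also have "\<dots> \<le> ennreal K * (hausdorff_gauge s (U i) + ennreal (e i))"
        using r by (intro mult_left_mono) auto
      finally show ?thesis using B by (auto intro: order_trans)
    qed
    then obtain B where B: "\<And>i. B i \<in> sets P" "\<And>i. {\<omega>\<in>G. \<pi> \<omega> \<in> U i} \<subseteq> B i"
        "\<And>i. emeasure P (B i) \<le> ennreal K * (hausdorff_gauge s (U i) + ennreal (e i))"
      by metis
    have "AE \<omega> in P. \<omega> \<in> (\<Union>i. B i)"
      using G
    proof eventually_elim
      case (elim \<omega>)
      then obtain i where "\<pi> \<omega> \<in> U i" using \<pi> cover by blast
      with elim B(2)[of i] show ?case by blast
    qed
    then have "1 = emeasure P (\<Union>i. B i)"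
      using prob_space.emeasure_eq_1_AE[OF P, of "\<Union>i. B i"] B(1) by auto
    also have "\<dots> \<le> (\<Sum>i. emeasure P (B i))"
      using B(1) by (intro emeasure_subadditive_countably) auto
    also have "\<dots> \<le> (\<Sum>i. ennreal K * (hausdorff_gauge s (U i) + ennreal (e i)))"
      using B(3) by (intro suminf_le) auto
    also have "\<dots> = ennreal K * ((\<Sum>i. hausdorff_gauge s (U i)) + (\<Sum>i. ennreal (e i)))"
      by (simp add: ennreal_suminf_cmult suminf_add)
    also have "(\<Sum>i. ennreal (e i)) = ennreal c"
    proof (rule suminf_ennreal_eq)
      show "e sums c"
        unfolding e_def using sums_mult[OF power_half_series, of c] by simp
    qed (use e in \<open>auto intro: less_imp_le\<close>)
    finally have *: "1 \<le> ennreal K * ((\<Sum>i. hausdorff_gauge s (U i)) + ennreal c)" .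
    show "ennreal c \<le> (\<Sum>i. hausdorff_gauge s (U i))"
    proof (rule ccontr)
      assume "\<not> ?thesis"
      then have less: "(\<Sum>i. hausdorff_gauge s (U i)) < ennreal c" by simp
      then obtain z where z: "z \<ge> 0" "(\<Sum>i. hausdorff_gauge s (U i)) = ennreal z" "z < c"
        by (cases "(\<Sum>i. hausdorff_gauge s (U i))") (auto simp: ennreal_less_iff)
      have "1 \<le> ennreal (K * (z + c))"
        using * z K c by (simp add: ennreal_mult ennreal_plus[symmetric] del: ennreal_plus)
      then have "1 \<le> K * (z + c)" by (simp)
      also have "\<dots> < K * (2 * c)" using z K by simp
      also have "\<dots> = 1" using K by (simp add: c_def)
      finally show False by simp
    qed
  qed
  also have "hausdorff_premeasure s (1/2) A \<le> hausdorff_measure s A"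
    unfolding hausdorff_measure_def by (intro SUP_upper) auto
  finally show ?thesis
    using c by (metis ennreal_less_zero_iff less_le_trans)
qed

section \<open>Cylinders of the full-branch map\<close>

locale full_branch =
  fixes p :: "nat \<Rightarrow> real" and I :: "nat \<Rightarrow> real set"
  assumes probability: "probability_sequence p" and partition: "interval_partition p I"
begin

definition left :: "nat \<Rightarrow> real" where
  "left k = Inf (I k)"

lemma p_pos: "k \<ge> 1 \<Longrightarrow> p k > 0"
  using probability by (auto simp: probability_sequence_def)

lemma branch_interval:
  assumes "k \<ge> 1"
  shows "I k = {left k..<left k + p k}"
proof -
  obtain a b where ab: "a < b" "I k = {a..<b}" "diameter (I k) = p k"
    using partition assms unfolding interval_partition_def by metis
  have "diameter {a..<b} = b - a"
    using diameter_closure[of "{a..<b}"] ab(1) by (simp add: diameter_closed_interval)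
  moreover have "left k = a" using ab by (simp add: left_def)
  ultimately have "p k = b - a" "left k = a" using ab by simp_all
  then show ?thesis using ab(2) by simp
qed

lemma left_bounds:
  assumes "k \<ge> 1"
  shows "0 \<le> left k" "left k + p k \<le> 1"
proof -
  have "I k \<subseteq> {0..<1}" using partition assms unfolding interval_partition_def by auto
  then show "0 \<le> left k" "left k + p k \<le> 1"
    using branch_interval[OF assms] p_pos[OF assms] by (auto simp: atLeastLessThan_subset_iff)
qed

lemma p_le_1: "k \<ge> 1 \<Longrightarrow> p k \<le> 1"
  using left_bounds[of k] by simp

lemma branch_unique: "j \<ge> 1 \<Longrightarrow> k \<ge> 1 \<Longrightarrow> x \<in> I j \<Longrightarrow> x \<in> I k \<Longrightarrow> j = k"
  using partition disjoint_family_onD[of I "{1..}" j k] unfolding interval_partition_def by auto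

lemma branch_index_eq: "k \<ge> 1 \<Longrightarrow> x \<in> I k \<Longrightarrow> branch_index I x = k"
  unfolding branch_index_def using branch_unique by (intro the_equality) auto

lemma rightmost_branch_unique:
  assumes "j \<ge> 1" "k \<ge> 1" "left j + p j = 1" "left k + p k = 1"
  shows "j = k"
proof (rule branch_unique)
  show "max (left j) (left k) \<in> I j" "max (left j) (left k) \<in> I k"
    unfolding branch_interval[OF assms(1)] branch_interval[OF assms(2)]
    using assms p_pos[of j] p_pos[of k] by (simp_all add: max_def)
qed fact+

lemma two_branches_le:
  assumes "j \<ge> 1" "k \<ge> 1" "j \<noteq> k"
  shows "p j + p k \<le> 1"
proof -
  have "sum p {j, k} \<le> 1"
    using probability p_pos assms unfolding probability_sequence_def
    by (intro finite_sum_le_has_sum[where A = "{1..}"]) (auto intro: less_imp_le)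
  then show ?thesis using assms by simp
qed

lemma p_uniformly_less_1:
  obtains \<theta> where "0 < \<theta>" "\<theta> < 1" "\<And>k. k \<ge> 1 \<Longrightarrow> p k \<le> \<theta>"
proof -
  define \<theta> where "\<theta> = 1 - min (p 1) (p 2)"
  have "p k \<le> \<theta>" if "k \<ge> 1" for k
    using two_branches_le[of 1 k] two_branches_le[of 2 k] that
    by (cases "k = 1") (auto simp: \<theta>_def min_def)
  moreover have "\<theta> < 1" using p_pos[of 1] p_pos[of 2] by (simp add: \<theta>_def)
  moreover have "0 < \<theta>" using calculation(1)[of 1] p_pos[of 1] by simp
  ultimately show ?thesis using that by blast
qed

primrec offset :: "nat list \<Rightarrow> real" where
  "offset [] = 0"
| "offset (k # w) = left k + p k * offset w"

definition len :: "nat list \<Rightarrow> real" where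
  "len w = prod_list (map p w)"

definition cyl :: "nat list \<Rightarrow> real set" where
  "cyl w = {offset w..<offset w + len w}"

lemma len_simps [simp]: "len [] = 1" "len (k # w) = p k * len w" "len (v @ w) = len v * len w"
  by (simp_all add: len_def)

lemma offset_append: "offset (v @ w) = offset v + len v * offset w"
  by (induction v) (auto simp: algebra_simps)

lemma len_pos: "set w \<subseteq> {1..} \<Longrightarrow> len w > 0"
  by (induction w) (auto simp: p_pos)

lemma cyl_bounds:
  assumes "set w \<subseteq> {1..}"
  shows "0 \<le> offset w" "offset w + len w \<le> 1"
  using assms
proof (induction w)
  case (Cons k w)
  case 1
  then show ?case using Cons left_bounds[of k] p_pos[of k] by auto
next
  case (Cons k w)
  case 2
  then have "p k * (offset w + len w) \<le> p k * 1"
    using Cons p_pos[of k] by (intro mult_left_mono) auto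
  then show ?case using 2 left_bounds[of k] by (auto simp: algebra_simps)
qed auto

lemma cyl_mono:
  assumes "set (v @ w) \<subseteq> {1..}"
  shows "cyl (v @ w) \<subseteq> cyl v"
proof -
  have "set v \<subseteq> {1..}" "set w \<subseteq> {1..}" using assms by auto
  then have "0 \<le> len v * offset w" "len v * (offset w + len w) \<le> len v * 1"
    using cyl_bounds[of w] len_pos[of v] by (auto intro!: mult_left_mono)
  then show ?thesis by (auto simp: cyl_def offset_append algebra_simps)
qed

lemma digit_in_cyl:
  assumes "set w \<subseteq> {1..}" "x \<in> cyl w" "i < length w"
  shows "digit p I (Suc i) x = w ! i"
  using assms
proof (induction w arbitrary: x i)
  case (Cons k w)
  have k: "k \<ge> 1" and w: "set w \<subseteq> {1..}" using Cons.prems by auto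
  define z where "z = (x - left k) / p k"
  have x: "x = left k + p k * z" using p_pos[OF k] by (simp add: z_def)
  have z: "z \<in> cyl w"
    using Cons.prems p_pos[OF k] unfolding cyl_def z_def by (auto simp: field_simps)
  then have "0 \<le> z" "z < 1" using cyl_bounds[OF w] by (auto simp: cyl_def)
  then have "x \<in> I k"
    using p_pos[OF k] by (auto simp: branch_interval[OF k] x)
  then have b: "branch_index I x = k" using k branch_index_eq by blast
  then have T: "full_branch_map p I x = z" by (simp add: full_branch_map_def z_def left_def)
  show ?case
  proof (cases i)
    case 0
    then show ?thesis using b by (simp add: digit_def)
  next
    case (Suc j)
    have "digit p I (Suc i) x = digit p I (Suc j) z"
      by (simp add: digit_def Suc funpow_Suc_right T del: funpow.simps)
    then show ?thesis using Cons.IH[OF w z, of j] Cons.prems Suc by simp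
  qed
qed simp

text \<open>Two cylinders with a common point read off the same digits, so the shorter word is a prefix.\<close>
lemma overlapping_cyl_prefix:
  assumes "set v \<subseteq> {1..}" "set w \<subseteq> {1..}" "x \<in> cyl v" "x \<in> cyl w" "length v \<le> length w"
  shows "v = take (length v) w"
proof (rule nth_equalityI)
  fix i assume "i < length v"
  then show "v ! i = take (length v) w ! i"
    using digit_in_cyl[of v x i] digit_in_cyl[of w x i] assms by simp
qed (use assms in simp)

text \<open>
  The closures of nested cylinders always share a point, but it may be the excluded right endpoint of
  one of them. From then on every digit would have to be that of the rightmost branch.
\<close>
lemma ex_point_with_digits:
  assumes pos: "\<And>i. \<omega> i \<ge> 1" and nonconst: "\<And>n. \<exists>m\<ge>n. \<omega> m \<noteq> \<omega> n"
  shows "\<exists>x\<in>{0..<1}. \<forall>n. x \<in> cyl (map \<omega> [0..<n])"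
proof -
  define lo where "lo n = offset (map \<omega> [0..<n])" for n
  define l where "l n = len (map \<omega> [0..<n])" for n
  have lo_Suc: "lo (Suc n) = lo n + l n * left (\<omega> n)" for n
    by (simp add: lo_def l_def offset_append)
  have l_Suc: "l (Suc n) = l n * p (\<omega> n)" for n
    by (simp add: l_def)
  have l_pos: "l n > 0" for n unfolding l_def by (rule len_pos) (use pos in auto)
  have hi_Suc: "lo (Suc n) + l (Suc n) = lo n + l n * (left (\<omega> n) + p (\<omega> n))" for n
    by (simp add: lo_Suc l_Suc algebra_simps)
  have inc: "incseq lo"
    using l_pos left_bounds pos by (intro incseq_SucI) (simp add: lo_Suc less_imp_le)
  have dec: "decseq (\<lambda>n. lo n + l n)"
  proof (rule decseq_SucI)
    fix n
    have "l n * (left (\<omega> n) + p (\<omega> n)) \<le> l n * 1"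
      using l_pos[of n] left_bounds[OF pos[of n]] by (intro mult_left_mono) auto
    then show "lo (Suc n) + l (Suc n) \<le> lo n + l n" by (simp add: hi_Suc)
  qed
  have cross: "lo m \<le> lo n + l n" for m n
  proof -
    have "lo m \<le> lo (max m n)" using inc by (simp add: incseq_def)
    also have "\<dots> \<le> lo (max m n) + l (max m n)" using l_pos[of "max m n"] by simp
    also have "\<dots> \<le> lo n + l n" using decseqD[OF dec, of n "max m n"] by simp
    finally show ?thesis .
  qed
  define x where "x = (SUP n. lo n)"
  have "bdd_above (range lo)" using cross[of _ 0] by (auto simp: bdd_above_def)
  then have lower: "lo n \<le> x" for n unfolding x_def by (intro cSUP_upper) auto
  have upper: "x \<le> lo n + l n" for n unfolding x_def using cross by (intro cSUP_least) auto
  have strict: "x < lo n + l n" for n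
  proof (rule ccontr)
    assume "\<not> x < lo n + l n"
    then have n: "x = lo n + l n" using upper[of n] by simp
    have stay: "x = lo (Suc m) + l (Suc m) \<and> left (\<omega> m) + p (\<omega> m) = 1" if "x = lo m + l m" for m
    proof -
      have "l m * 1 \<le> l m * (left (\<omega> m) + p (\<omega> m))"
        using upper[of "Suc m"] that by (simp add: hi_Suc)
      then have "left (\<omega> m) + p (\<omega> m) = 1"
        using l_pos[of m] left_bounds(2)[OF pos[of m]] by simp
      then show ?thesis using that by (simp add: hi_Suc)
    qed
    have "x = lo m + l m" if "m \<ge> n" for m
      using that by (induction m rule: dec_induct) (use n stay in auto)
    then have "left (\<omega> m) + p (\<omega> m) = 1" if "m \<ge> n" for m
      using stay that by blast
    then show False
      using nonconst[of n] rightmost_branch_unique pos by (metis order_refl)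
  qed
  have "x \<in> cyl (map \<omega> [0..<n])" for n
    using lower[of n] strict[of n] by (auto simp: cyl_def lo_def l_def)
  moreover from this[of 0] have "x \<in> {0..<1}" by (simp add: cyl_def)
  ultimately show ?thesis by blast
qed

end

section \<open>Mass of Moran sets\<close>

text \<open>
  Each interval contains a piece of length at least \<open>\<delta> r\<close> within distance \<open>2 r\<close> of a fixed point of
  \<open>U\<close>, and these pieces are disjoint inside an interval of length \<open>4 r\<close>.
\<close>
lemma card_disjoint_intervals_le:
  fixes a b :: "'i \<Rightarrow> real"
  assumes F: "finite F" and U: "bounded U" "diameter U \<le> r"
    and r: "r > 0" and \<delta>: "0 < \<delta>" "\<delta> \<le> 1"
    and disj: "disjoint_family_on (\<lambda>i. {a i..<b i}) F"
    and len: "\<And>i. i \<in> F \<Longrightarrow> b i - a i \<ge> \<delta> * r"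
    and meet: "\<And>i. i \<in> F \<Longrightarrow> {a i..<b i} \<inter> U \<noteq> {}"
  shows "real (card F) \<le> 4 / \<delta>"
proof (cases "F = {}")
  case False
  then obtain c where c: "c \<in> U" using meet by blast
  define a' where "a' i = max (a i) (c - 2 * r)" for i
  define b' where "b' i = min (b i) (c + 2 * r)" for i
  have \<delta>r: "\<delta> * r \<le> r" using \<delta> r by simp
  have len': "\<delta> * r \<le> b' i - a' i" if i: "i \<in> F" for i
  proof -
    obtain u where u: "u \<in> U" "a i \<le> u" "u < b i" using meet[OF i] by auto
    have "\<bar>u - c\<bar> \<le> r"
      using diameter_bounded_bound[OF U(1) u(1) c] U(2) by (simp add: dist_real_def)
    then show ?thesis
      using u len[OF i] \<delta>r r unfolding a'_def b'_def by linarith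
  qed
  have \<delta>r0: "0 < \<delta> * r" using \<delta> r by simp
  have disj': "disjoint_family_on (\<lambda>i. {a' i..<b' i}) F"
    using disj unfolding disjoint_family_on_def a'_def b'_def by fastforce
  have "(\<Sum>i\<in>F. measure lborel {a' i..<b' i}) = measure lborel (\<Union>i\<in>F. {a' i..<b' i})"
    using F disj' len' \<delta>r0
    by (intro measure_finite_Union[symmetric]) (force simp: emeasure_lborel_Ico)+
  also have "\<dots> \<le> measure lborel {c - 2 * r..c + 2 * r}"
    by (intro measure_mono_fmeasurable)
      (auto simp: a'_def b'_def fmeasurable_def less_top[symmetric] emeasure_lborel_Icc_eq
        intro!: sets.finite_UN F)
  also have "\<dots> = 4 * r" using r by simp
  finally have "(\<Sum>i\<in>F. measure lborel {a' i..<b' i}) \<le> 4 * r" .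
  moreover have "(\<Sum>i\<in>F. \<delta> * r) \<le> (\<Sum>i\<in>F. measure lborel {a' i..<b' i})"
  proof (rule sum_mono)
    fix i assume "i \<in> F"
    with len' \<delta>r0 show "\<delta> * r \<le> measure lborel {a' i..<b' i}"
      by (smt (verit) measure_lborel_Ico)
  qed
  ultimately have "real (card F) * \<delta> * r \<le> 4 * r" by simp
  then have "real (card F) * \<delta> \<le> 4" using r by simp
  then show ?thesis using \<delta> by (simp add: field_simps)
qed (use \<delta> in auto)

definition supported :: "(nat \<Rightarrow> nat pmf) \<Rightarrow> nat list \<Rightarrow> bool" where
  "supported Q w \<longleftrightarrow> (\<forall>i<length w. w ! i \<in> set_pmf (Q i))"

lemma emeasure_PiM_pmf_cylinder:
  fixes Q :: "nat \<Rightarrow> nat pmf"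
  shows "emeasure (PiM UNIV (\<lambda>i. measure_pmf (Q i)))
      {\<omega> \<in> space (PiM UNIV (\<lambda>i. measure_pmf (Q i))). \<forall>i\<in>{..<length w}. \<omega> i \<in> {w ! i}} =
    ennreal (\<Prod>i<length w. pmf (Q i) (w ! i))"
proof -
  interpret product_prob_space "\<lambda>i. measure_pmf (Q i)" UNIV
    by unfold_locales
  show ?thesis
    by (subst emeasure_PiM_Collect) (auto simp: emeasure_pmf_single prod_ennreal)
qed

context full_branch
begin

text \<open>
  The words of the cylinder decomposition of a Moran set at scale \<open>r\<close>, as far as they are seen by \<open>U\<close>:
  the first cylinders along each branch that have length at most \<open>r\<close>.
\<close>
definition stopping_words :: "(nat \<Rightarrow> nat pmf) \<Rightarrow> real \<Rightarrow> real set \<Rightarrow> nat list set" where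
  "stopping_words Q r U =
     {w. supported Q w \<and> len w \<le> r \<and> (\<forall>n<length w. r < len (take n w)) \<and> cyl w \<inter> U \<noteq> {}}"

text \<open>
  A forced digit may make a cylinder much shorter than \<open>r\<close>. Such a cylinder is represented by its
  parent, which is longer than \<open>r\<close> and has no other admitted child, so that representatives of
  different words remain disjoint.
\<close>
definition anchor :: "real \<Rightarrow> nat list \<Rightarrow> nat list" where
  "anchor c w = (if c \<le> len w then w else butlast w)"

text \<open>
  If the cylinders of two anchors share a point, the shorter anchor is a prefix of the other word.
  Stopping words are never proper prefixes of each other, so the shorter anchor must be the parent of
  \<open>v\<close>; then the last digit of \<open>v\<close> was forced, and \<open>w\<close> must continue the parent with it as well.
\<close>
lemma anchor_cyl_disjoint:
  assumes pos: "\<And>i k. k \<in> set_pmf (Q i) \<Longrightarrow> k \<ge> 1"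
    and step: "\<And>i. (\<exists>k. Q i = return_pmf k) \<or> (\<forall>k\<in>set_pmf (Q i). \<delta> \<le> p k)"
    and r: "0 < r" "r < 1" and \<delta>: "0 < \<delta>" "\<delta> \<le> 1"
    and v: "v \<in> stopping_words Q r U" and w: "w \<in> stopping_words Q r U"
    and x: "x \<in> cyl (anchor (\<delta> * r) v)" "x \<in> cyl (anchor (\<delta> * r) w)"
    and shorter: "length (anchor (\<delta> * r) v) \<le> length (anchor (\<delta> * r) w)"
  shows "v = w"
proof (rule ccontr)
  assume "v \<noteq> w"
  have letters: "set u \<subseteq> {1..}" if "supported Q u" for u
    using that pos by (fastforce simp: supported_def in_set_conv_nth)
  have sup: "supported Q v" "supported Q w" using v w by (auto simp: stopping_words_def)
  define a where "a = anchor (\<delta> * r) v"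
  define b where "b = anchor (\<delta> * r) w"
  have ab: "set a \<subseteq> {1..}" "set b \<subseteq> {1..}"
    using letters[OF sup(1)] letters[OF sup(2)]
    unfolding a_def b_def anchor_def by (auto dest: in_set_butlastD split: if_splits)
  have "a = take (length a) b"
    using overlapping_cyl_prefix[OF ab] x shorter by (simp add: a_def b_def)
  moreover have "b = take (length b) w" by (auto simp: b_def anchor_def butlast_conv_take)
  ultimately have a_w: "a = take (length a) w"
    by (metis take_take min_def length_take linorder_le_cases take_all)
  have not_prefix: "v \<noteq> take (length v) w"
  proof
    assume eq: "v = take (length v) w"
    with \<open>v \<noteq> w\<close> have "length v < length w" by (metis not_le take_all)
    then have "r < len (take (length v) w)" using w by (auto simp: stopping_words_def)
    then show False using v eq by (auto simp: stopping_words_def)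
  qed
  then have a: "a = butlast v" "len v < \<delta> * r"
    using a_w by (auto simp: a_def anchor_def split: if_splits)
  have "\<delta> * r \<le> r" using \<delta> r by simp
  with a(2) r(2) have "v \<noteq> []" by fastforce
  define n where "n = length v - 1"
  have n: "n < length v" "a = take n v" "length a = n" "v = take n v @ [v ! n]"
    using \<open>v \<noteq> []\<close> take_Suc_conv_app_nth[of n v]
    by (auto simp: n_def a(1) butlast_conv_take)
  have long: "r < len (take n v)" using v n(1) by (auto simp: stopping_words_def)
  have "len v = len (take n v) * p (v ! n)"
    by (subst n(4)) simp
  have vn: "v ! n \<in> set_pmf (Q n)" using sup(1) n(1) by (auto simp: supported_def)
  \<comment> \<open>The step from the parent shrinks by more than \<open>\<delta>\<close>, so its digit cannot have been free.\<close>
  have "p (v ! n) < \<delta>"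
  proof (rule ccontr)
    assume "\<not> p (v ! n) < \<delta>"
    then have "r * \<delta> \<le> len (take n v) * p (v ! n)"
      using long r p_pos[OF pos[OF vn]] \<delta> by (intro mult_mono) auto
    then show False using a(2) \<open>len v = _\<close> by (simp add: mult.commute)
  qed
  then obtain k where k: "Q n = return_pmf k" using step[of n] vn by fastforce
  show False
  proof (cases "n < length w")
    case True
    then have "w ! n = v ! n" using sup(2) vn k by (auto simp: supported_def)
    then have "v = take (Suc n) w"
      using n a_w True by (metis take_Suc_conv_app_nth)
    moreover have "Suc n = length v" using n(1) by (simp add: n_def)
    ultimately show False using not_prefix by simp
  next
    case False
    then have "a = w" using a_w n(3) by simp
    then have "len w > r" using long n(2) by simp
    then show False using w by (auto simp: stopping_words_def)
  qed
qed

text \<open>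
  The representing cylinders are disjoint intervals that meet \<open>U\<close> and have length at least \<open>\<delta> r\<close>.
  For \<open>r < 1\<close> the empty word is longer than \<open>r\<close>, so every stopping word has a parent.
\<close>
lemma card_stopping_words_le:
  assumes pos: "\<And>i k. k \<in> set_pmf (Q i) \<Longrightarrow> k \<ge> 1"
    and step: "\<And>i. (\<exists>k. Q i = return_pmf k) \<or> (\<forall>k\<in>set_pmf (Q i). \<delta> \<le> p k)"
    and r: "0 < r" "r < 1" and \<delta>: "0 < \<delta>" "\<delta> \<le> 1"
    and U: "bounded U" "diameter U \<le> r"
  shows "finite (stopping_words Q r U)" "real (card (stopping_words Q r U)) \<le> 4 / \<delta>"
proof -
  let ?S = "stopping_words Q r U" and ?J = "\<lambda>w. cyl (anchor (\<delta> * r) w)"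
  have \<delta>r: "\<delta> * r \<le> r" using \<delta> r by simp
  have letters: "set w \<subseteq> {1..}" if "w \<in> ?S" for w
    using that pos by (fastforce simp: stopping_words_def supported_def in_set_conv_nth)
  have long: "\<delta> * r \<le> len (anchor (\<delta> * r) w)" if w: "w \<in> ?S" for w
  proof (cases "\<delta> * r \<le> len w")
    case False
    then have "w \<noteq> []" using \<delta>r r(2) by fastforce
    then have "r < len (take (length w - 1) w)"
      using w by (auto simp: stopping_words_def)
    then show ?thesis using False \<delta>r by (simp add: anchor_def butlast_conv_take)
  qed (simp add: anchor_def)
  have meet: "?J w \<inter> U \<noteq> {}" if w: "w \<in> ?S" for w
  proof -
    have "cyl w \<subseteq> cyl (butlast w)"
      using cyl_mono[of "butlast w" "[last w]"] letters[OF w] by (cases "w = []") auto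
    then show ?thesis using w by (auto simp: anchor_def stopping_words_def)
  qed
  have disj: "disjoint_family_on ?J ?S"
  proof -
    have "v = w" if vw: "v \<in> ?S" "w \<in> ?S" and x: "x \<in> ?J v" "x \<in> ?J w" for v w x
      using linear[of "length (anchor (\<delta> * r) v)" "length (anchor (\<delta> * r) w)"]
    proof
      assume "length (anchor (\<delta> * r) v) \<le> length (anchor (\<delta> * r) w)"
      then show ?thesis
        by (intro anchor_cyl_disjoint[where x = x and v = v, OF _ step r \<delta> vw x] pos)
    next
      assume "length (anchor (\<delta> * r) w) \<le> length (anchor (\<delta> * r) v)"
      then show ?thesis
        by (intro anchor_cyl_disjoint[where x = x and v = w, OF _ step r \<delta> vw(2,1) x(2,1), symmetric] pos)
    qed
    then show ?thesis unfolding disjoint_family_on_def by blast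
  qed
  have bound: "card F \<le> nat \<lfloor>4 / \<delta>\<rfloor>" if "F \<subseteq> ?S" "finite F" for F
  proof -
    have "real (card F) \<le> 4 / \<delta>"
    proof (rule card_disjoint_intervals_le[OF that(2) U r(1) \<delta>])
      show "disjoint_family_on
          (\<lambda>w. {offset (anchor (\<delta> * r) w)..<offset (anchor (\<delta> * r) w) + len (anchor (\<delta> * r) w)}) F"
        using disjoint_family_on_mono[OF that(1) disj] by (simp add: cyl_def)
    qed (use that long meet in \<open>auto simp: cyl_def\<close>)
    then show ?thesis by linarith
  qed
  have fin: "finite ?S \<and> card ?S \<le> nat \<lfloor>4 / \<delta>\<rfloor>"
    by (rule finite_if_finite_subsets_card_bdd) (use bound in blast)
  then show "finite ?S" by simp
  have "4 / \<delta> \<ge> 0" using \<delta> by simp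
  then show "real (card ?S) \<le> 4 / \<delta>" using fin by linarith
qed

lemma len_tendsto_0:
  assumes "\<And>i. \<omega> i \<ge> 1"
  shows "(\<lambda>n. len (map \<omega> [0..<n])) \<longlonglongrightarrow> 0"
proof -
  obtain \<theta> where \<theta>: "0 < \<theta>" "\<theta> < 1" "\<And>k. k \<ge> 1 \<Longrightarrow> p k \<le> \<theta>"
    using p_uniformly_less_1 by blast
  have pos: "0 < len (map \<omega> [0..<n])" for n
    by (rule len_pos) (use assms in auto)
  have le: "len (map \<omega> [0..<n]) \<le> \<theta> ^ n" for n
  proof (induction n)
    case (Suc n)
    have "len (map \<omega> [0..<n]) * p (\<omega> n) \<le> \<theta> ^ n * \<theta>"
      using Suc \<theta> assms[of n] p_pos[of "\<omega> n"] by (intro mult_mono) auto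
    then show ?case by (simp add: mult.commute)
  qed simp
  show ?thesis
  proof (rule tendsto_sandwich[of "\<lambda>_. 0" _ _ "\<lambda>n. \<theta> ^ n"])
    show "(\<lambda>n. \<theta> ^ n) \<longlonglongrightarrow> 0" using \<theta> by (intro LIMSEQ_power_zero) simp
  qed (use pos le less_imp_le in \<open>auto intro!: always_eventually\<close>)
qed

text \<open>
  The digits are drawn independently, the \<open>i\<close>-th one from \<open>Q i\<close>. If cylinders satisfy the mass bound,
  so do arbitrary sets of diameter \<open>r\<close>, because they meet boundedly many stopping cylinders.
\<close>
lemma hausdorff_measure_moran_set_pos:
  assumes pos: "\<And>i k. k \<in> set_pmf (Q i) \<Longrightarrow> k \<ge> 1"
    and nonconst: "\<And>\<omega> n. (\<And>i. \<omega> i \<in> set_pmf (Q i)) \<Longrightarrow> \<exists>m\<ge>n. \<omega> m \<noteq> \<omega> n"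
    and step: "\<And>i. (\<exists>k. Q i = return_pmf k) \<or> (\<forall>k\<in>set_pmf (Q i). \<delta> \<le> p k)"
    and mass: "\<And>w. supported Q w \<Longrightarrow> (\<Prod>i<length w. pmf (Q i) (w ! i)) \<le> C * len w powr s"
    and s: "0 \<le> s" and \<delta>: "0 < \<delta>" "\<delta> \<le> 1" and C: "0 < C"
  shows "hausdorff_measure s {x \<in> {0..<1}. \<forall>i. digit p I (Suc i) x \<in> set_pmf (Q i)} > 0"
proof -
  define P where "P = PiM UNIV (\<lambda>i. measure_pmf (Q i))"
  interpret product_prob_space "\<lambda>i. measure_pmf (Q i)" UNIV
    by unfold_locales
  have P: "prob_space P" unfolding P_def by (rule prob_space_axioms)
  define G where "G = {\<omega>. \<forall>i. \<omega> i \<in> set_pmf (Q i)}"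
  define \<pi> where "\<pi> \<omega> = (SOME x. x \<in> {0..<1} \<and> (\<forall>n. x \<in> cyl (map \<omega> [0..<n])))"
    for \<omega> :: "nat \<Rightarrow> nat"
  have \<pi>: "\<pi> \<omega> \<in> {0..<1} \<and> (\<forall>n. \<pi> \<omega> \<in> cyl (map \<omega> [0..<n]))" if "\<omega> \<in> G" for \<omega>
    unfolding \<pi>_def
  proof (rule someI_ex)
    show "\<exists>x. x \<in> {0..<1} \<and> (\<forall>n. x \<in> cyl (map \<omega> [0..<n]))"
      using ex_point_with_digits[of \<omega>] that pos nonconst unfolding G_def by blast
  qed
  show ?thesis
  proof (rule mass_distribution_principle[OF P, where G = G and \<pi> = \<pi> and K = "4 / \<delta> * C"])
    have "AE \<omega> in P. \<omega> i \<in> set_pmf (Q i)" for i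
      unfolding P_def by (rule AE_component) (auto simp: AE_measure_pmf)
    then show "AE \<omega> in P. \<omega> \<in> G" by (simp add: G_def AE_all_countable)
  next
    fix \<omega> assume \<omega>: "\<omega> \<in> G"
    have "digit p I (Suc i) (\<pi> \<omega>) = \<omega> i" for i
    proof -
      have "\<pi> \<omega> \<in> cyl (map \<omega> [0..<Suc i])" using \<pi>[OF \<omega>] by blast
      then have "digit p I (Suc i) (\<pi> \<omega>) = map \<omega> [0..<Suc i] ! i"
        by (rule digit_in_cyl[rotated]) (use \<omega> pos in \<open>auto simp: G_def\<close>)
      also have "\<dots> = \<omega> i" by (subst nth_map) (auto simp del: upt_Suc)
      finally show ?thesis .
    qed
    then show "\<pi> \<omega> \<in> {x \<in> {0..<1}. \<forall>i. digit p I (Suc i) x \<in> set_pmf (Q i)}"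
      using \<pi>[OF \<omega>] \<omega> by (simp add: G_def)
  next
    fix U :: "real set" and r :: real
    assume U: "bounded U" "diameter U \<le> r" and r: "0 < r" "r < 1"
    let ?S = "stopping_words Q r U"
    define Z where "Z w = {\<omega> \<in> space P. \<forall>i\<in>{..<length w}. \<omega> i \<in> {w ! i}}" for w
    have Z_sets: "Z w \<in> sets P" for w
      unfolding Z_def
    proof (rule sets.sets_Collect_finite_All)
      fix i
      show "{\<omega> \<in> space P. \<omega> i \<in> {w ! i}} \<in> sets P"
        unfolding P_def by (rule sets_Collect_single) auto
    qed auto
    have Z: "emeasure P (Z w) = ennreal (\<Prod>i<length w. pmf (Q i) (w ! i))" for w
      unfolding Z_def P_def by (rule emeasure_PiM_pmf_cylinder)
    note S = card_stopping_words_le[OF pos step r \<delta> U]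
    have "emeasure P (\<Union>w\<in>?S. Z w) \<le> (\<Sum>w\<in>?S. emeasure P (Z w))"
      using S(1) Z_sets by (intro emeasure_subadditive_finite) auto
    also have "\<dots> \<le> (\<Sum>w\<in>?S. ennreal (C * r powr s))"
    proof (rule sum_mono)
      fix w assume w: "w \<in> ?S"
      then have "set w \<subseteq> {1..}"
        using pos by (fastforce simp: stopping_words_def supported_def in_set_conv_nth)
      then have "len w powr s \<le> r powr s"
        using w s len_pos[of w] by (intro powr_mono2) (auto simp: stopping_words_def)
      then have "(\<Prod>i<length w. pmf (Q i) (w ! i)) \<le> C * r powr s"
        using mass[of w] w C by (smt (verit) mult_left_mono stopping_words_def mem_Collect_eq)
      then show "emeasure P (Z w) \<le> ennreal (C * r powr s)"
        unfolding Z by (rule ennreal_leI)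
    qed
    also have "\<dots> = ennreal (real (card ?S) * (C * r powr s))"
      using C by (simp add: ennreal_of_nat_eq_real_of_nat ennreal_mult)
    also have "\<dots> \<le> ennreal (4 / \<delta> * (C * r powr s))"
      using S(2) C by (intro ennreal_leI mult_right_mono) auto
    finally have "emeasure P (\<Union>w\<in>?S. Z w) \<le> ennreal (4 / \<delta> * C * r powr s)"
      by (simp only: mult.assoc)
    moreover have "{\<omega> \<in> G. \<pi> \<omega> \<in> U} \<subseteq> (\<Union>w\<in>?S. Z w)"
    proof safe
      fix \<omega> assume \<omega>: "\<omega> \<in> G" "\<pi> \<omega> \<in> U"
      have "eventually (\<lambda>n. len (map \<omega> [0..<n]) < r) sequentially"
        using len_tendsto_0[of \<omega>] \<omega>(1) pos r by (auto simp: G_def order_tendsto_iff)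
      then have ex: "\<exists>n. len (map \<omega> [0..<n]) \<le> r"
        by (auto simp: eventually_sequentially intro: less_imp_le)
      define n where "n = (LEAST n. len (map \<omega> [0..<n]) \<le> r)"
      define w where "w = map \<omega> [0..<n]"
      have "len w \<le> r" unfolding w_def n_def by (rule LeastI_ex[OF ex])
      moreover have "r < len (take m w)" if "m < length w" for m
        using not_less_Least[of m "\<lambda>n. len (map \<omega> [0..<n]) \<le> r"] that
        by (auto simp: w_def n_def take_map)
      ultimately have "w \<in> ?S"
        using \<omega> \<pi>[OF \<omega>(1)] by (auto simp: stopping_words_def supported_def w_def G_def)
      moreover have "\<omega> \<in> Z w" by (auto simp: Z_def w_def P_def space_PiM)
      ultimately show "\<omega> \<in> (\<Union>w\<in>?S. Z w)" by blast
    qed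
    ultimately show "\<exists>B\<in>sets P. {\<omega> \<in> G. \<pi> \<omega> \<in> U} \<subseteq> B \<and>
        emeasure P B \<le> ennreal (4 / \<delta> * C * r powr s)"
      using S(1) Z_sets by (intro bexI[of _ "\<Union>w\<in>?S. Z w"] conjI) auto
  qed (use s \<delta> C in auto)
qed

end

section \<open>Regular variation\<close>

lemma positive_lower_bound:
  fixes h :: "nat \<Rightarrow> real"
  assumes pos: "\<And>k. k \<ge> 1 \<Longrightarrow> h k > 0" and "c > 0" and "eventually (\<lambda>k. c \<le> h k) sequentially"
  shows "\<exists>c'>0. \<forall>k\<ge>1. c' \<le> h k"
proof -
  obtain N where N: "\<And>k. k \<ge> N \<Longrightarrow> c \<le> h k"
    using assms(3) by (auto simp: eventually_sequentially)
  define c' where "c' = Min (insert c (h ` {1..N}))"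
  have "c' > 0" using pos \<open>c > 0\<close> by (auto simp: c'_def)
  moreover have "c' \<le> h k" if "k \<ge> 1" for k
  proof (cases "k \<le> N")
    case True
    then show ?thesis unfolding c'_def using that by (intro Min_le) auto
  next
    case False
    have "c' \<le> c" by (simp add: c'_def)
    also have "c \<le> h k" using N False by simp
    finally show ?thesis .
  qed
  ultimately show ?thesis by blast
qed

text \<open>
  Halving the argument changes \<open>L\<close> by a factor at most \<open>2\<close> in the long run, so \<open>k L(k)\<close> is
  eventually at least its value at \<open>k div 2\<close>.
\<close>
lemma slowly_varying_lower_bound:
  assumes "slowly_varying L"
  shows "\<exists>c>0. \<forall>k\<ge>1. c / real k \<le> L k"
proof -
  have pos: "L k > 0" if "k \<ge> 1" for k using assms that by (auto simp: slowly_varying_def)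
  have "(\<lambda>k. L (nat \<lfloor>1/2 * real k\<rfloor>) / L k) \<longlonglongrightarrow> 1"
    using assms unfolding slowly_varying_def by (meson half_gt_zero zero_less_one)
  moreover have "nat \<lfloor>1/2 * real k\<rfloor> = k div 2" for k by linarith
  ultimately have "(\<lambda>k. L (k div 2) / L k) \<longlonglongrightarrow> 1" by simp
  then have "eventually (\<lambda>k. L (k div 2) / L k < 2) sequentially"
    by (rule order_tendstoD) simp
  then obtain N where N: "\<And>k. k \<ge> N \<Longrightarrow> L (k div 2) / L k < 2"
    by (auto simp: eventually_sequentially)
  define N' where "N' = max N 2"
  define c where "c = Min ((\<lambda>k. real k * L k) ` {1..N'})"
  have "N' \<ge> 1" by (simp add: N'_def)
  then have "c > 0" using pos by (auto simp: c_def)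
  moreover have "c \<le> real k * L k" if "k \<ge> 1" for k
    using that
  proof (induction k rule: less_induct)
    case (less k)
    show ?case
    proof (cases "k \<le> N'")
      case True
      then show ?thesis using less.prems by (auto simp: c_def)
    next
      case False
      then have k: "k \<ge> N" "k \<ge> 2" by (auto simp: N'_def)
      then have "c \<le> real (k div 2) * L (k div 2)" by (intro less.IH) auto
      also have "\<dots> \<le> real (k div 2) * (2 * L k)"
        using N[OF k(1)] pos[of k] k by (intro mult_left_mono) (auto simp: field_simps)
      also have "\<dots> = (2 * real (k div 2)) * L k" by simp
      also have "\<dots> \<le> real k * L k"
        using pos[of k] k by (intro mult_right_mono) linarith+
      finally show ?thesis .
    qed
  qed
  then have "c / real k \<le> L k" if "k \<ge> 1" for k using that by (simp add: field_simps)
  ultimately show ?thesis by blast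
qed

lemma regularly_varying_lower_bound:
  assumes "regularly_varying p \<rho>" and pos: "\<And>k. k \<ge> 1 \<Longrightarrow> p k > 0"
  shows "\<exists>c>0. \<forall>k\<ge>1. c \<le> p k * real k powr (\<rho> + 1)"
proof -
  obtain L where L: "slowly_varying L" "(\<lambda>k. p k / (real k powr (-\<rho>) * L k)) \<longlonglongrightarrow> 1"
    using assms(1) by (auto simp: regularly_varying_def)
  obtain c where c: "c > 0" "\<And>k. k \<ge> 1 \<Longrightarrow> c / real k \<le> L k"
    using slowly_varying_lower_bound[OF L(1)] by blast
  have "eventually (\<lambda>k. p k / (real k powr (-\<rho>) * L k) > 1/2) sequentially"
    using L(2) by (rule order_tendstoD) simp
  moreover have "eventually (\<lambda>k. k \<ge> (1::nat)) sequentially"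
    by (rule eventually_ge_at_top)
  ultimately have "eventually (\<lambda>k. c / 2 \<le> p k * real k powr (\<rho> + 1)) sequentially"
  proof eventually_elim
    case (elim k)
    have Lk: "L k > 0" using c(1) c(2)[OF elim(2)] elim(2)
      by (smt (verit) divide_pos_pos of_nat_0_less_iff less_le_trans zero_less_one)
    have k: "real k powr (-\<rho>) > 0" using elim(2) by simp
    have "real k powr (-\<rho>) * (c / real k) / 2 \<le> real k powr (-\<rho>) * L k / 2"
      using c(2)[OF elim(2)] k by (intro divide_right_mono mult_left_mono) auto
    also have "\<dots> \<le> p k" using elim(1) k Lk by (simp add: field_simps)
    finally have "real k powr (-\<rho>) * (c / real k) / 2 * real k powr (\<rho> + 1) \<le>
        p k * real k powr (\<rho> + 1)" by (intro mult_right_mono) auto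
    also have "real k powr (-\<rho>) * (c / real k) / 2 * real k powr (\<rho> + 1) =
        c / 2 * (real k powr (-\<rho>) * real k powr (\<rho> + 1) / real k)"
      by (simp only: mult_ac times_divide_eq_left times_divide_eq_right divide_divide_eq_left)
    also have "real k powr (-\<rho>) * real k powr (\<rho> + 1) = real k"
      using elim(2) by (simp flip: powr_add)
    finally show ?case using elim(2) by simp
  qed
  then show ?thesis
    using c(1) pos by (intro positive_lower_bound[where c = "c / 2"]) auto
qed

section \<open>Inserting new digits\<close>

lemma filterlim_admissible:
  assumes "admissible f"
  shows "filterlim f at_top sequentially"
proof -
  have mono: "f m \<le> f n" if "1 \<le> m" "m \<le> n" for m n
    using that(2,1)
  proof (induction n rule: dec_induct)
    case (step n)
    have "0 \<le> f (n + 1) - f n" using assms step by (auto simp: admissible_def)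
    with step show ?case by simp
  qed simp
  have unb: "\<exists>n\<ge>1. f n > K" for K
  proof (rule ccontr)
    assume "\<not> ?thesis"
    then have "\<forall>x\<in>f ` {1..}. norm x \<le> K"
      using assms by (auto simp: admissible_def not_less less_imp_le)
    then have "bounded (f ` {1..})" by (auto simp: bounded_iff)
    then show False using assms by (simp add: admissible_def)
  qed
  show ?thesis
    unfolding filterlim_at_top eventually_sequentially
  proof
    fix K
    obtain m where "m \<ge> 1" "f m > K" using unb by blast
    then show "\<exists>N. \<forall>n\<ge>N. K \<le> f n" using mono[of m] by (meson less_imp_le order_trans)
  qed
qed

definition unit_steps :: "(nat \<Rightarrow> nat) \<Rightarrow> bool" where
  "unit_steps g \<longleftrightarrow> (\<forall>n\<ge>1. g (Suc n) = g n \<or> g (Suc n) = Suc (g n))"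

lemma unit_steps_mono:
  assumes "unit_steps g" "1 \<le> i" "i \<le> j"
  shows "g i \<le> g j"
  using assms(3)
proof (induction j rule: dec_induct)
  case (step n)
  have "n \<ge> 1" using step(1) assms(2) by simp
  then have "g n \<le> g (Suc n)" using assms(1) unfolding unit_steps_def by fastforce
  then show ?case using step.IH by simp
qed simp

lemma unit_steps_floor_admissible:
  assumes "admissible f"
  shows "unit_steps (\<lambda>n. nat \<lfloor>f n\<rfloor>)"
  unfolding unit_steps_def
proof (intro allI impI)
  fix n :: nat assume "n \<ge> 1"
  then have "0 < f n" "0 \<le> f (Suc n) - f n" "f (Suc n) - f n \<le> 1"
    using assms by (auto simp: admissible_def)
  then show "nat \<lfloor>f (Suc n)\<rfloor> = nat \<lfloor>f n\<rfloor> \<or> nat \<lfloor>f (Suc n)\<rfloor> = Suc (nat \<lfloor>f n\<rfloor>)" by linarith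
qed

text \<open>
  A jump from \<open>g 0\<close> to \<open>g 1\<close> does not count, as \<^const>\<open>unit_steps\<close> constrains \<open>g\<close> from index \<open>1\<close>
  on; the first digit is therefore always free.
\<close>
definition insertion :: "(nat \<Rightarrow> nat) \<Rightarrow> nat \<Rightarrow> bool" where
  "insertion g i \<longleftrightarrow> i \<ge> 1 \<and> g (Suc i) = Suc (g i)"

text \<open>
  The law of the digit number \<open>i + 1\<close>. When the target \<open>g\<close> jumps, a digit beyond \<open>M\<close> is forced that
  has not been used before; all other digits follow the law \<open>q\<close> on \<open>{1..M}\<close>.
\<close>
definition digit_law :: "nat pmf \<Rightarrow> nat \<Rightarrow> (nat \<Rightarrow> nat) \<Rightarrow> nat \<Rightarrow> nat pmf" where
  "digit_law q M g i = (if insertion g i then return_pmf (M + g (Suc i)) else q)"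

text \<open>
  Free digits stay in \<open>{1..M}\<close>, and the forced ones run through \<open>M + g 1 + 1, M + g 1 + 2, \<dots>\<close>
  without gaps because \<open>g\<close> moves in unit steps. Hence the number of distinct digits follows \<open>g\<close> up
  to a bounded error.
\<close>
lemma digits_above:
  assumes g: "unit_steps g" and q: "set_pmf q \<subseteq> {1..M}"
    and d: "\<And>i. d (Suc i) \<in> set_pmf (digit_law q M g i)" and n: "n \<ge> 1"
  shows "d ` {1..n} \<inter> {M<..} = {M + g 1<..M + g n}"
  using n
proof (induction n rule: dec_induct)
  case base
  have "d 1 \<le> M" using d[of 0] q by (auto simp: digit_law_def insertion_def)
  then show ?case by auto
next
  case (step n)
  have split: "d ` {1..Suc n} = insert (d (Suc n)) (d ` {1..n})"
    by (simp add: atLeastAtMostSuc_conv)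
  have mono: "g 1 \<le> g n" using unit_steps_mono[OF g order_refl step(1)] .
  show ?case
  proof (cases "insertion g n")
    case True
    then have "d (Suc n) = M + g (Suc n)" "g (Suc n) = Suc (g n)"
      using d[of n] by (auto simp: digit_law_def insertion_def)
    then have "d ` {1..Suc n} \<inter> {M<..} = insert (M + Suc (g n)) (d ` {1..n} \<inter> {M<..})"
      unfolding split by auto
    also have "\<dots> = {M + g 1<..M + g (Suc n)}"
      unfolding step.IH using mono \<open>g (Suc n) = Suc (g n)\<close> by auto
    finally show ?thesis .
  next
    case False
    then have "d (Suc n) \<le> M" "g (Suc n) = g n"
      using d[of n] q g step(1) by (auto simp: digit_law_def insertion_def unit_steps_def)
    then have "d ` {1..Suc n} \<inter> {M<..} = d ` {1..n} \<inter> {M<..}"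
      unfolding split by auto
    then show ?thesis using step.IH \<open>g (Suc n) = g n\<close> by simp
  qed
qed

lemma card_digits_bounds:
  assumes "unit_steps g" "set_pmf q \<subseteq> {1..M}"
    and "\<And>i. d (Suc i) \<in> set_pmf (digit_law q M g i)" and "n \<ge> 1"
  shows "g n \<le> card (d ` {1..n}) + g 1" "card (d ` {1..n}) \<le> g n + Suc M"
proof -
  note above = digits_above[OF assms]
  have "card (d ` {1..n} \<inter> {M<..}) \<le> card (d ` {1..n})" by (intro card_mono) auto
  then show "g n \<le> card (d ` {1..n}) + g 1" unfolding above by simp
  have "d ` {1..n} = (d ` {1..n} \<inter> {M<..}) \<union> (d ` {1..n} \<inter> {..M})" by auto
  then have "card (d ` {1..n}) \<le> card (d ` {1..n} \<inter> {M<..}) + card (d ` {1..n} \<inter> {..M})"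
    by (metis card_Un_le)
  also have "card (d ` {1..n} \<inter> {..M}) \<le> card {..M}" by (intro card_mono) auto
  finally show "card (d ` {1..n}) \<le> g n + Suc M" unfolding above by simp
qed

lemma digit_count_ratio_tendsto_1:
  assumes f: "admissible f" and q: "set_pmf q \<subseteq> {1..M}"
    and d: "\<And>i. d (Suc i) \<in> set_pmf (digit_law q M (\<lambda>n. nat \<lfloor>f n\<rfloor>) i)"
  shows "(\<lambda>n. real (card (d ` {1..n})) / f n) \<longlonglongrightarrow> 1"
proof -
  let ?D = "\<lambda>n. real (card (d ` {1..n}))"
  define K where "K = real M + real (nat \<lfloor>f 1\<rfloor>) + 1"
  have near: "\<bar>?D n - f n\<bar> \<le> K" if n: "n \<ge> 1" for n
  proof -
    have "f n > 0" using f n by (auto simp: admissible_def)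
    then show ?thesis
      using card_digits_bounds[OF unit_steps_floor_admissible[OF f] q d n]
      unfolding K_def by linarith
  qed
  have lim: "filterlim f at_top sequentially" by (rule filterlim_admissible[OF f])
  then have inv: "(\<lambda>n. K / f n) \<longlonglongrightarrow> 0"
    by (rule real_tendsto_divide_at_top[OF tendsto_const])
  have "(\<lambda>n. ?D n / f n - 1) \<longlonglongrightarrow> 0"
  proof (rule Lim_null_comparison[OF _ inv])
    show "eventually (\<lambda>n. norm (?D n / f n - 1) \<le> K / f n) sequentially"
      using eventually_ge_at_top[of 1]
    proof eventually_elim
      case (elim n)
      then have "f n > 0" using f by (auto simp: admissible_def)
      then have "?D n / f n - 1 = (?D n - f n) / f n" by (simp add: field_simps)
      then show ?case
        using near[OF elim] \<open>f n > 0\<close> by (simp add: divide_right_mono)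
    qed
  qed
  then show ?thesis by (simp add: LIM_zero_iff)
qed

text \<open>
  New digits keep arriving, which excludes the sequences that could run into an omitted right endpoint.
\<close>
lemma digit_law_not_eventually_constant:
  assumes g: "unit_steps g" and unb: "filterlim g at_top sequentially"
    and \<omega>: "\<And>i. \<omega> i \<in> set_pmf (digit_law q M g i)"
  shows "\<exists>m\<ge>n. \<omega> m \<noteq> \<omega> n"
proof (rule ccontr)
  assume "\<not> ?thesis"
  then have const: "\<omega> m = \<omega> n" if "m \<ge> n" for m using that by blast
  define n0 where "n0 = max n 1"
  have "g m \<le> max (g n0) (\<omega> n)" if "m \<ge> n0" for m
    using that
  proof (induction m rule: dec_induct)
    case (step m)
    show ?case
    proof (cases "insertion g m")
      case True
      then have "\<omega> m = M + g (Suc m)" using \<omega>[of m] by (simp add: digit_law_def)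
      moreover have "\<omega> m = \<omega> n" using step(1) by (intro const) (simp add: n0_def)
      ultimately show ?thesis by simp
    next
      case False
      have "m \<ge> 1" using step(1) by (simp add: n0_def)
      with False g have "g (Suc m) = g m" by (auto simp: insertion_def unit_steps_def)
      then show ?thesis using step.IH by simp
    qed
  qed simp
  moreover have "eventually (\<lambda>m. g m \<ge> Suc (max (g n0) (\<omega> n))) sequentially"
    using unb by (simp add: filterlim_at_top)
  then obtain m where "m \<ge> n0" "g m \<ge> Suc (max (g n0) (\<omega> n))"
    by (metis (mono_tags, lifting) eventually_sequentially linorder_le_cases)
  ultimately show False by fastforce
qed

text \<open>
  The factor by which the digit number \<open>i + 1\<close> can make the mass of a cylinder exceed the \<open>s\<close>-th power
  of its length. Free digits contribute a gain \<open>1/Z < 1\<close>, forced ones a loss.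
\<close>
definition mass_excess :: "(nat \<Rightarrow> real) \<Rightarrow> real \<Rightarrow> nat \<Rightarrow> (nat \<Rightarrow> nat) \<Rightarrow> nat \<Rightarrow> real" where
  "mass_excess p Z M g i = (if insertion g i then 1 / p (M + g (Suc i)) else 1 / Z)"

text \<open>
  Each jump of \<open>g\<close> replaces one factor \<open>1 / Z\<close> by a factor of size at most \<open>K\<close>.
\<close>
lemma prod_mass_excess_le:
  assumes g: "unit_steps g" and Z: "Z > 1" and K: "K \<ge> 1"
    and pos: "\<And>k. k \<ge> 1 \<Longrightarrow> p k > 0"
    and bound: "\<And>j. 1 \<le> j \<Longrightarrow> j \<le> g n \<Longrightarrow> 1 / p (M + j) \<le> K" and n: "n \<ge> 1"
  shows "(\<Prod>i<n. mass_excess p Z M g i) \<le> (Z * K) ^ g n / Z ^ n"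
proof -
  have nonneg: "0 \<le> mass_excess p Z M g i" for i
    using Z pos[of "M + g (Suc i)"] by (auto simp: mass_excess_def insertion_def)
  have ZK: "1 \<le> Z * K" using Z K by (smt (verit) mult_le_cancel_left1)
  have "(\<Prod>i<m. mass_excess p Z M g i) \<le> (Z * K) ^ g m / Z ^ m" if "1 \<le> m" "m \<le> n" for m
    using that
  proof (induction m rule: dec_induct)
    case base
    have "1 \<le> (Z * K) ^ g 1" using ZK by (rule one_le_power)
    then show ?case using Z by (simp add: mass_excess_def insertion_def divide_right_mono)
  next
    case (step m)
    have IH: "(\<Prod>i<m. mass_excess p Z M g i) \<le> (Z * K) ^ g m / Z ^ m"
      using step by simp
    have "(\<Prod>i<Suc m. mass_excess p Z M g i) \<le> (Z * K) ^ g m / Z ^ m * mass_excess p Z M g m"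
      using mult_right_mono[OF IH nonneg[of m]] by simp
    also have "\<dots> \<le> (Z * K) ^ g (Suc m) / Z ^ Suc m"
    proof (cases "insertion g m")
      case True
      have "g (Suc m) \<le> g n" using unit_steps_mono[OF g, of "Suc m" n] step by simp
      then have "mass_excess p Z M g m \<le> K"
        using bound[of "g (Suc m)"] True by (simp add: mass_excess_def insertion_def)
      then have "(Z * K) ^ g m / Z ^ m * mass_excess p Z M g m \<le> (Z * K) ^ g m / Z ^ m * K"
        using Z K by (intro mult_left_mono) auto
      also have "\<dots> = (Z * K) ^ g (Suc m) / Z ^ Suc m"
        using True Z by (simp add: insertion_def)
      finally show ?thesis .
    next
      case False
      then have "g (Suc m) = g m" using g step(1) by (auto simp: insertion_def unit_steps_def)
      then show ?thesis using False by (simp add: mass_excess_def mult.commute)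
    qed
    finally show ?case .
  qed
  then show ?thesis using n by simp
qed

text \<open>
  By time \<open>n\<close> at most \<open>f(n)\<close> digits were forced, each costing a power of \<open>f(n)\<close>. The total cost
  \<open>exp (O(f(n) log f(n)))\<close> is beaten by the exponential gain of the free digits.
\<close>
lemma prod_mass_excess_bounded:
  assumes f: "admissible f" and Z: "Z > 1"
    and pos: "\<And>k. k \<ge> 1 \<Longrightarrow> p k > 0"
    and c: "c > 0" and lower: "\<And>k. k \<ge> 1 \<Longrightarrow> c \<le> p k * real k powr B" and B: "B \<ge> 0"
  shows "\<exists>C>0. \<forall>n. (\<Prod>i<n. mass_excess p Z M (\<lambda>n. nat \<lfloor>f n\<rfloor>) i) \<le> C"
proof -
  define g where "g n = nat \<lfloor>f n\<rfloor>" for n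
  let ?E = "\<lambda>n. \<Prod>i<n. mass_excess p Z M g i"
  have g: "unit_steps g" unfolding g_def by (rule unit_steps_floor_admissible[OF f])
  define c' where "c' = min c 1"
  have c': "0 < c'" "c' \<le> 1" "c' \<le> c" using c by (auto simp: c'_def)
  (* A + B * ln (f n) bounds the logarithm of the cost of one forced digit. *)
  define A where "A = ln Z - ln c' + B * ln (real M + 1)"
  have A: "A \<ge> 0"
  proof -
    have "0 \<le> ln Z" "ln c' \<le> 0" "0 \<le> ln (real M + 1)" using Z c' by auto
    then show ?thesis using B by (simp add: A_def)
  qed
  have lim: "filterlim f at_top sequentially" by (rule filterlim_admissible[OF f])
  have "(\<lambda>n. (A + B) * (f n * ln (f n) / real n)) \<longlonglongrightarrow> (A + B) * 0"
    using f by (intro tendsto_mult_left) (simp add: admissible_def)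
  then have "eventually (\<lambda>n. (A + B) * (f n * ln (f n) / real n) < ln Z) sequentially"
    by (rule order_tendstoD) (use Z in simp)
  moreover have "eventually (\<lambda>n. f n \<ge> exp 1) sequentially"
    using lim by (simp add: filterlim_at_top)
  ultimately have "eventually (\<lambda>n. ?E n \<le> 1) sequentially"
    using eventually_ge_at_top[of 1]
  proof eventually_elim
    case (elim n)
    have f1: "f n \<ge> 1" using elim(2) by (smt (verit) exp_ge_add_one_self)
    have lnf: "ln (f n) \<ge> 1" using elim(2) f1 by (simp add: ln_ge_iff)
    (* The digits forced up to time n are at most M + f n <= (M + 1) * f n. *)
    define K where "K = (1 / c') * ((real M + 1) * f n) powr B"
    have "(real M + 1) * f n \<ge> 1" using f1 by (smt (verit) mult_le_cancel_right1 of_nat_0_le_iff)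
    then have one: "((real M + 1) * f n) powr B \<ge> 1" using B by (intro ge_one_powr_ge_zero)
    then have K: "K \<ge> 1" using c' unfolding K_def
      by (smt (verit) divide_le_eq_1_pos le_divide_eq_1_pos mult_le_cancel_right1)
    have gf: "real (g n) \<le> f n" using f1 by (simp add: g_def)
    have bound: "1 / p (M + j) \<le> K" if j: "1 \<le> j" "j \<le> g n" for j
    proof -
      have pj: "p (M + j) > 0" using pos j by simp
      have "real (M + j) \<le> real M + f n" using j gf by simp
      also have "\<dots> \<le> (real M + 1) * f n"
        using f1 mult_left_mono[of 1 "f n" "real M"] by (simp add: algebra_simps)
      finally have "real (M + j) powr B \<le> ((real M + 1) * f n) powr B"
        using B by (intro powr_mono2) auto
      then have "p (M + j) * real (M + j) powr B \<le> p (M + j) * ((real M + 1) * f n) powr B"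
        using pj by (intro mult_left_mono) auto
      then have "c' \<le> p (M + j) * ((real M + 1) * f n) powr B"
        using lower[of "M + j"] j c' by simp
      then show ?thesis using pj c' by (simp add: K_def field_simps)
    qed
    have "?E n \<le> (Z * K) ^ g n / Z ^ n"
      using g Z K pos bound elim(3) by (intro prod_mass_excess_le) auto
    also have "\<dots> = exp (real (g n) * ln (Z * K) - real n * ln Z)"
      using Z K by (simp add: exp_diff exp_of_nat_mult)
    also have "\<dots> \<le> exp 0"
    proof (subst exp_le_cancel_iff)
      have "ln K = B * ln ((real M + 1) * f n) - ln c'"
        using c' f1 unfolding K_def by (subst ln_mult) (auto simp: ln_powr ln_div)
      also have "ln ((real M + 1) * f n) = ln (real M + 1) + ln (f n)"
        using f1 by (subst ln_mult) auto
      finally have lnZK: "ln (Z * K) = A + B * ln (f n)"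
        using Z K by (simp add: A_def ln_mult algebra_simps)
      have "real (g n) * ln (Z * K) \<le> f n * (A + B * ln (f n))"
        unfolding lnZK using gf A B lnf by (intro mult_right_mono) auto
      also have "\<dots> \<le> f n * (A * ln (f n) + B * ln (f n))"
        using f1 lnf A mult_left_mono[of 1 "ln (f n)" A] by (intro mult_left_mono) auto
      also have "\<dots> = (A + B) * (f n * ln (f n) / real n) * real n"
        using elim(3) by (simp add: field_simps)
      also have "\<dots> \<le> ln Z * real n"
        using elim(1) by (intro mult_right_mono) auto
      finally show "real (g n) * ln (Z * K) - real n * ln Z \<le> 0" by (simp add: mult.commute)
    qed
    finally show ?case by simp
  qed
  then obtain N where N: "\<And>n. n \<ge> N \<Longrightarrow> ?E n \<le> 1" by (auto simp: eventually_sequentially)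
  define C where "C = Max (insert 1 (?E ` {..N}))"
  have "?E n \<le> C" for n
  proof (cases "n \<le> N")
    case True
    then show ?thesis unfolding C_def by (intro Max_ge) auto
  next
    case False
    then have "?E n \<le> 1" using N by simp
    also have "1 \<le> C" by (simp add: C_def)
    finally show ?thesis .
  qed
  moreover have "1 \<le> C" by (simp add: C_def)
  ultimately show ?thesis unfolding g_def by (intro exI[of _ C]) auto
qed

section \<open>Points with a prescribed number of distinct digits\<close>

lemma ex_pmf_proportional:
  fixes w :: "'a \<Rightarrow> real"
  assumes A: "finite A" "A \<noteq> {}" and w: "\<And>k. k \<in> A \<Longrightarrow> w k > 0"
  shows "\<exists>q. set_pmf q = A \<and> (\<forall>k\<in>A. pmf q k = w k / sum w A)"
proof -
  define h where "h k = (if k \<in> A then w k / sum w A else 0)" for k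
  have S: "sum w A > 0" using A w by (intro sum_pos) auto
  have h0: "0 \<le> h k" for k using w S by (auto simp: h_def less_imp_le)
  have "(\<integral>\<^sup>+ k. ennreal (h k) \<partial>count_space UNIV) = (\<Sum>k\<in>A. ennreal (h k))"
    using A by (intro nn_integral_count_space') (auto simp: h_def)
  also have "\<dots> = ennreal (\<Sum>k\<in>A. h k)" using h0 by (intro sum_ennreal) auto
  also have "(\<Sum>k\<in>A. h k) = (\<Sum>k\<in>A. w k / sum w A)" by (simp add: h_def)
  also have "\<dots> = 1" using S by (simp flip: sum_divide_distrib)
  finally have one: "(\<integral>\<^sup>+ k. ennreal (h k) \<partial>count_space UNIV) = 1" by simp
  have "set_pmf (embed_pmf h) = A"
    unfolding set_embed_pmf[OF h0 one] using w S by (force simp: h_def)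
  moreover have "\<forall>k\<in>A. pmf (embed_pmf h) k = w k / sum w A"
    by (simp add: pmf_embed_pmf[OF h0 one] h_def)
  ultimately show ?thesis by blast
qed

context full_branch
begin

text \<open>
  The factors \<open>p k powr (s - 1)\<close> are bounded below by a constant larger than \<open>1\<close>, since the \<open>p k\<close>
  stay away from \<open>1\<close>, whereas the partial sums of \<open>p\<close> tend to \<open>1\<close>.
\<close>
lemma ex_partial_sum_powr_gt_1:
  assumes "s < 1"
  shows "\<exists>M. (\<Sum>k=1..M. p k powr s) > 1"
proof -
  obtain \<theta> where \<theta>: "0 < \<theta>" "\<theta> < 1" "\<And>k. k \<ge> 1 \<Longrightarrow> p k \<le> \<theta>"
    using p_uniformly_less_1 by blast
  have \<theta>1: "\<theta> powr (1 - s) < 1"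
    using \<theta>(1,2) assms powr_less_mono2[of "1 - s" \<theta> 1] by simp
  have le: "p k \<le> p k powr s * \<theta> powr (1 - s)" if k: "k \<ge> 1" for k
  proof -
    have "p k = p k powr s * p k powr (1 - s)" using p_pos[OF k] by (simp flip: powr_add)
    also have "\<dots> \<le> p k powr s * \<theta> powr (1 - s)"
      using \<theta>(3)[OF k] p_pos[OF k] assms by (intro mult_left_mono powr_mono2) auto
    finally show ?thesis .
  qed
  have "(sum p \<longlongrightarrow> 1) (finite_subsets_at_top {1..})"
    using probability by (simp add: probability_sequence_def has_sum_def)
  then have "eventually (\<lambda>F. sum p F > \<theta> powr (1 - s)) (finite_subsets_at_top {1..})"
    using \<theta>1 by (rule order_tendstoD)
  then obtain F where F: "finite F" "F \<subseteq> {1..}" "sum p F > \<theta> powr (1 - s)"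
    unfolding eventually_finite_subsets_at_top by blast
  have "\<theta> powr (1 - s) < sum p F" by (rule F(3))
  also have "\<dots> \<le> (\<Sum>k\<in>F. p k powr s * \<theta> powr (1 - s))"
    using le F(2) by (intro sum_mono) auto
  also have "\<dots> \<le> (\<Sum>k=1..Max F. p k powr s * \<theta> powr (1 - s))"
    using F by (intro sum_mono2) auto
  also have "\<dots> = (\<Sum>k=1..Max F. p k powr s) * \<theta> powr (1 - s)"
    by (simp add: sum_distrib_right)
  finally show ?thesis using \<theta>(1) by (intro exI[of _ "Max F"]) simp
qed

lemma len_powr:
  assumes "set w \<subseteq> {1..}"
  shows "len w powr s = (\<Prod>i<length w. p (w ! i) powr s)"
  using assms
proof (induction w rule: rev_induct)
  case (snoc k w)
  then show ?case using len_pos[of w] p_pos[of k] by (simp add: powr_mult nth_append)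
qed simp

text \<open>
  A forced digit \<open>k\<close> has probability \<open>1\<close> instead of \<open>p k powr s\<close>, which is at least \<open>p k\<close>; this is
  where the factor \<open>1 / p k\<close> in \<^const>\<open>mass_excess\<close> comes from.
\<close>
lemma cylinder_mass_le:
  assumes q: "set_pmf q = {1..M}" "\<And>k. k \<in> {1..M} \<Longrightarrow> pmf q k = p k powr s / Z"
    and Z: "Z > 1" and s: "s < 1"
    and w: "supported (digit_law q M g) w"
  shows "(\<Prod>i<length w. pmf (digit_law q M g i) (w ! i)) \<le>
    len w powr s * (\<Prod>i<length w. mass_excess p Z M g i)"
proof -
  have pos: "w ! i \<ge> 1" if "i < length w" for i
    using w that q(1) by (auto simp: supported_def digit_law_def insertion_def split: if_splits)
  then have letters: "set w \<subseteq> {1..}" by (auto simp: in_set_conv_nth)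
  have "(\<Prod>i<length w. pmf (digit_law q M g i) (w ! i)) \<le>
      (\<Prod>i<length w. p (w ! i) powr s * mass_excess p Z M g i)"
  proof (intro prod_mono conjI)
    fix i assume "i \<in> {..<length w}"
    then have i: "w ! i \<in> set_pmf (digit_law q M g i)" "w ! i \<ge> 1"
      using w pos by (auto simp: supported_def)
    show "pmf (digit_law q M g i) (w ! i) \<le> p (w ! i) powr s * mass_excess p Z M g i"
    proof (cases "insertion g i")
      case True
      then have wi: "w ! i = M + g (Suc i)" using i by (simp add: digit_law_def)
      have "p (w ! i) powr 1 \<le> p (w ! i) powr s"
        using s p_pos[OF i(2)] p_le_1[OF i(2)] by (intro powr_mono') auto
      then show ?thesis
        using True p_pos[OF i(2)] by (simp add: digit_law_def mass_excess_def wi)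
    next
      case False
      then show ?thesis using i q by (simp add: digit_law_def mass_excess_def)
    qed
  qed auto
  also have "\<dots> = len w powr s * (\<Prod>i<length w. mass_excess p Z M g i)"
    by (simp add: len_powr[OF letters] prod.distrib)
  finally show ?thesis .
qed

text \<open>
  The Moran set of \<^const>\<open>digit_law\<close> with target \<open>\<lfloor>f n\<rfloor>\<close> lies in the set in question. The free
  law is \<open>p k powr s\<close> normalised on \<open>{1..M}\<close>, with \<open>M\<close> so large that the normalising constant \<open>Z\<close>
  exceeds \<open>1\<close>; the least \<open>p k\<close> with \<open>k \<le> M\<close> bounds the shrinking of cylinders at free steps.
\<close>
lemma hausdorff_measure_digit_count_set_pos:
  assumes reg: "regularly_varying p \<rho>" "\<rho> \<ge> 1" and f: "admissible f" and s: "0 \<le> s" "s < 1"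
  shows "hausdorff_measure s
    {x \<in> {0..<1}. (\<lambda>n. real (distinct_digits p I n x) / f n) \<longlonglongrightarrow> 1} > 0"
proof -
  obtain M where M: "(\<Sum>k=1..M. p k powr s) > 1"
    using ex_partial_sum_powr_gt_1[OF s(2)] by blast
  define Z where "Z = (\<Sum>k=1..M. p k powr s)"
  have Z: "Z > 1" using M by (simp add: Z_def)
  have "M \<ge> 1" using M by (cases M) auto
  obtain q where q: "set_pmf q = {1..M}" "\<And>k. k \<in> {1..M} \<Longrightarrow> pmf q k = p k powr s / Z"
    using ex_pmf_proportional[of "{1..M}" "\<lambda>k. p k powr s"] \<open>M \<ge> 1\<close> p_pos
    unfolding Z_def by force
  define g where "g n = nat \<lfloor>f n\<rfloor>" for n
  have g: "unit_steps g" unfolding g_def by (rule unit_steps_floor_admissible[OF f])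
  have g_top: "filterlim g at_top sequentially"
    unfolding g_def using filterlim_admissible[OF f]
    by (intro filterlim_compose[OF filterlim_nat_sequentially]
      filterlim_compose[OF filterlim_floor_sequentially])
  define Q where "Q = digit_law q M g"
  obtain c where c: "c > 0" "\<And>k. k \<ge> 1 \<Longrightarrow> c \<le> p k * real k powr (\<rho> + 1)"
    using regularly_varying_lower_bound[OF reg(1) p_pos] by blast
  obtain C where C: "C > 0" "\<And>n. (\<Prod>i<n. mass_excess p Z M g i) \<le> C"
    using prod_mass_excess_bounded[OF f Z p_pos c, of M] reg(2) unfolding g_def by auto
  define \<delta> where "\<delta> = Min (p ` {1..M})"
  have \<delta>: "0 < \<delta>" "\<delta> \<le> 1" "\<And>k. k \<in> {1..M} \<Longrightarrow> \<delta> \<le> p k"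
  proof -
    show "0 < \<delta>" using \<open>M \<ge> 1\<close> p_pos by (auto simp: \<delta>_def)
    show le: "\<delta> \<le> p k" if "k \<in> {1..M}" for k using that by (auto simp: \<delta>_def)
    show "\<delta> \<le> 1" using le[of 1] p_le_1[of 1] \<open>M \<ge> 1\<close> by simp
  qed
  have "hausdorff_measure s {x \<in> {0..<1}. \<forall>i. digit p I (Suc i) x \<in> set_pmf (Q i)} > 0"
  proof (rule hausdorff_measure_moran_set_pos)
    fix i k assume "k \<in> set_pmf (Q i)"
    then show "k \<ge> 1"
      using q(1) by (auto simp: Q_def digit_law_def insertion_def split: if_splits)
  next
    fix \<omega> n assume "\<And>i. \<omega> i \<in> set_pmf (Q i)"
    then show "\<exists>m\<ge>n. \<omega> m \<noteq> \<omega> n"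
      unfolding Q_def by (rule digit_law_not_eventually_constant[OF g g_top])
  next
    fix i show "(\<exists>k. Q i = return_pmf k) \<or> (\<forall>k\<in>set_pmf (Q i). \<delta> \<le> p k)"
      using q(1) \<delta>(3) by (auto simp: Q_def digit_law_def)
  next
    fix w assume w: "supported Q w"
    have "(\<Prod>i<length w. pmf (Q i) (w ! i)) \<le> len w powr s * (\<Prod>i<length w. mass_excess p Z M g i)"
      using cylinder_mass_le[OF q Z s(2)] w unfolding Q_def by simp
    also have "\<dots> \<le> len w powr s * C" using C(2) by (intro mult_left_mono) auto
    finally show "(\<Prod>i<length w. pmf (Q i) (w ! i)) \<le> C * len w powr s"
      by (simp add: mult.commute)
  qed (use s \<delta> C in auto)
  also have "\<dots> \<le> hausdorff_measure s
      {x \<in> {0..<1}. (\<lambda>n. real (distinct_digits p I n x) / f n) \<longlonglongrightarrow> 1}"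
  proof (rule hausdorff_measure_mono, safe)
    fix x assume "\<forall>i. digit p I (Suc i) x \<in> set_pmf (Q i)"
    then show "(\<lambda>n. real (distinct_digits p I n x) / f n) \<longlonglongrightarrow> 1"
      unfolding distinct_digits_def Q_def g_def
      by (intro digit_count_ratio_tendsto_1[OF f, of q M]) (use q in auto)
  qed
  finally show ?thesis .
qed

end

theorem theorem2:
  fixes p :: "nat \<Rightarrow> real" and I :: "nat \<Rightarrow> real set" and \<rho> :: real and f :: "nat \<Rightarrow> real"
  assumes "probability_sequence p"
    and "\<rho> \<ge> 1"
    and "regularly_varying p \<rho>"
    and "interval_partition p I"
    and "admissible f"
  shows "hausdorff_dim
           {x \<in> {0..<1}. (\<lambda>n. real (distinct_digits p I n x) / f n) \<longlonglongrightarrow> 1} = 1"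
proof -
  interpret full_branch p I
    by (rule full_branch.intro[OF assms(1,4)])
  show ?thesis
  proof (rule antisym)
    show "hausdorff_dim {x \<in> {0..<1}. (\<lambda>n. real (distinct_digits p I n x) / f n) \<longlonglongrightarrow> 1} \<le> 1"
      by (rule hausdorff_dim_le_1) auto
    show "1 \<le> hausdorff_dim {x \<in> {0..<1}. (\<lambda>n. real (distinct_digits p I n x) / f n) \<longlonglongrightarrow> 1}"
      using assms by (intro hausdorff_dim_ge_1 hausdorff_measure_digit_count_set_pos)
  qed
qed

end
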